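(* Let $L$ be a hyperabelian Lie algebra over a field $F$. Suppose that $L$ is non-abelian. If every abelian subideal of $L$ is an ideal of $L$, then $L = A \oplus Fd$ (direct sum of vector spaces), where $A$ is an abelian ideal of $L$, $d \in L$, and $[d, a] = a$ for all elements $a \in A$. In particular, every subideal of $L$ is an ideal.
   Context: A Lie algebra $L$ (of arbitrary dimension) is hyperabelian if it has an ascending (possibly transfinite) series of ideals, from $\langle 0\rangle$ to $L$, whose factors are abelian. A subalgebra $S$ of $L$ is a subideal if there is a finite chain $S = S_0 \leq S_1 \leq \cdots \leq S_n = L$ of subalgebras with each $S_i$ an ideal of $S_{i+1}$. *)

theory Defs
  imports Complex_Main
begin

text \<open>
  A Lie algebra has as its underlying space a whole type, as in the library locale
  \<^locale>\<open>vector_space\<close>; subalgebras and ideals are subsets of that type.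
\<close>

locale lie_algebra = vector_space scale
  for scale :: "'a::field \<Rightarrow> 'v::ab_group_add \<Rightarrow> 'v" +
  fixes bracket :: "'v \<Rightarrow> 'v \<Rightarrow> 'v"
  assumes linear_right: "Vector_Spaces.linear scale scale (\<lambda>y. bracket x y)"
    and linear_left: "Vector_Spaces.linear scale scale (\<lambda>x. bracket x y)"
    and alternating: "bracket x x = 0"
    and jacobi: "bracket x (bracket y z) + bracket y (bracket z x) + bracket z (bracket x y) = 0"

definition lie_subalgebra ::
  "('a::field \<Rightarrow> 'v::ab_group_add \<Rightarrow> 'v) \<Rightarrow> ('v \<Rightarrow> 'v \<Rightarrow> 'v) \<Rightarrow> 'v set \<Rightarrow> bool" where
  "lie_subalgebra scale bracket S \<longleftrightarrow>
     module.subspace scale S \<and> (\<forall>x\<in>S. \<forall>y\<in>S. bracket x y \<in> S)"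

text \<open>In \<open>lie_ideal scale bracket I S\<close>, \<open>I\<close> is an ideal of the subalgebra \<open>S\<close>.\<close>

definition lie_ideal ::
  "('a::field \<Rightarrow> 'v::ab_group_add \<Rightarrow> 'v) \<Rightarrow> ('v \<Rightarrow> 'v \<Rightarrow> 'v) \<Rightarrow> 'v set \<Rightarrow> 'v set \<Rightarrow> bool" where
  "lie_ideal scale bracket I S \<longleftrightarrow>
     module.subspace scale I \<and> I \<subseteq> S \<and> (\<forall>x\<in>S. \<forall>y\<in>I. bracket x y \<in> I)"

definition lie_subideal ::
  "('a::field \<Rightarrow> 'v::ab_group_add \<Rightarrow> 'v) \<Rightarrow> ('v \<Rightarrow> 'v \<Rightarrow> 'v) \<Rightarrow> 'v set \<Rightarrow> 'v set \<Rightarrow> bool" where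
  "lie_subideal scale bracket S L \<longleftrightarrow>
     (\<exists>(n::nat) T. T 0 = S \<and> T n = L \<and>
        (\<forall>i\<le>n. lie_subalgebra scale bracket (T i)) \<and>
        (\<forall>i<n. lie_ideal scale bracket (T i) (T (Suc i))))"

definition lie_abelian :: "('v::ab_group_add \<Rightarrow> 'v \<Rightarrow> 'v) \<Rightarrow> 'v set \<Rightarrow> bool" where
  "lie_abelian bracket S \<longleftrightarrow> (\<forall>x\<in>S. \<forall>y\<in>S. bracket x y = 0)"

text \<open>
  The quotient of \<open>J\<close> by \<open>I\<close> is abelian: the bracket of the cosets of \<open>x\<close> and \<open>y\<close> is the coset
  of \<open>bracket x y\<close>, which is zero iff \<open>bracket x y \<in> I\<close>.
\<close>

definition abelian_factor :: "('v::ab_group_add \<Rightarrow> 'v \<Rightarrow> 'v) \<Rightarrow> 'v set \<Rightarrow> 'v set \<Rightarrow> bool" where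
  "abelian_factor bracket J I \<longleftrightarrow> (\<forall>x\<in>J. \<forall>y\<in>J. bracket x y \<in> I)"

definition is_succ :: "'i rel \<Rightarrow> 'i \<Rightarrow> 'i \<Rightarrow> bool" where
  "is_succ r i j \<longleftrightarrow> i \<in> underS r j \<and> (\<forall>k. i \<in> underS r k \<longrightarrow> (j, k) \<in> r)"

text \<open>
  An ascending series is indexed by the ordinals up to and including some ordinal \<open>\<lambda>\<close>; such an
  initial segment is represented by a well-order with a greatest element.
\<close>

definition ascending_abelian_series ::
  "('a::field \<Rightarrow> 'v::ab_group_add \<Rightarrow> 'v) \<Rightarrow> ('v \<Rightarrow> 'v \<Rightarrow> 'v) \<Rightarrow> 'v set \<Rightarrow>
   'i rel \<Rightarrow> ('i \<Rightarrow> 'v set) \<Rightarrow> bool" where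
  "ascending_abelian_series scale bracket L r f \<longleftrightarrow>
     Well_order r \<and>
     (\<exists>i\<in>Field r. (\<forall>j\<in>Field r. (i, j) \<in> r) \<and> f i = {0}) \<and>
     (\<exists>i\<in>Field r. (\<forall>j\<in>Field r. (j, i) \<in> r) \<and> f i = L) \<and>
     (\<forall>i\<in>Field r. lie_ideal scale bracket (f i) L) \<and>
     (\<forall>i j. (i, j) \<in> r \<longrightarrow> f i \<subseteq> f j) \<and>
     (\<forall>i j. is_succ r i j \<longrightarrow> abelian_factor bracket (f j) (f i)) \<and>
     (\<forall>j\<in>Field r. underS r j \<noteq> {} \<and> (\<nexists>i. is_succ r i j) \<longrightarrow> f j = (\<Union>i\<in>underS r j. f i))"

text \<open>
  HOL cannot quantify over the index type inside a definition. Indices of type \<open>'v set\<close>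
  suffice, since after removing repetitions a series is indexed by its own terms; the lemma
  \<open>hyperabelianI\<close> below makes this precise.
\<close>

definition hyperabelian ::
  "('a::field \<Rightarrow> 'v::ab_group_add \<Rightarrow> 'v) \<Rightarrow> ('v \<Rightarrow> 'v \<Rightarrow> 'v) \<Rightarrow> 'v set \<Rightarrow> bool" where
  "hyperabelian scale bracket L \<longleftrightarrow>
     (\<exists>(r :: 'v set rel) f. ascending_abelian_series scale bracket L r f)"

lemma hyperabelianI:
  fixes r :: "'i rel" and L :: "'v::ab_group_add set"
  assumes "ascending_abelian_series scale bracket L r f"
  shows "hyperabelian scale bracket L"
proof -
  note P = assms[unfolded ascending_abelian_series_def]
  note wo = P[THEN conjunct1]
  have ideal: "\<And>i. i \<in> Field r \<Longrightarrow> lie_ideal scale bracket (f i) L"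
    using P[THEN conjunct2, THEN conjunct2, THEN conjunct2, THEN conjunct1] by blast
  have mono: "\<And>i j. (i, j) \<in> r \<Longrightarrow> f i \<subseteq> f j"
    using P[THEN conjunct2, THEN conjunct2, THEN conjunct2, THEN conjunct2, THEN conjunct1]
    by blast
  have factor: "\<And>i j. is_succ r i j \<Longrightarrow> abelian_factor bracket (f j) (f i)"
    using P[THEN conjunct2, THEN conjunct2, THEN conjunct2, THEN conjunct2, THEN conjunct2,
        THEN conjunct1] by blast
  have limit: "\<And>j. j \<in> Field r \<Longrightarrow> underS r j \<noteq> {} \<Longrightarrow> \<nexists>i. is_succ r i j \<Longrightarrow>
                 f j = (\<Union>i\<in>underS r j. f i)"
    using P[THEN conjunct2, THEN conjunct2, THEN conjunct2, THEN conjunct2, THEN conjunct2,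
        THEN conjunct2] by simp
  obtain b where b: "b \<in> Field r" "\<And>j. j \<in> Field r \<Longrightarrow> (b, j) \<in> r" "f b = {0}"
    using P[THEN conjunct2, THEN conjunct1] by blast
  obtain t where t: "t \<in> Field r" "\<And>j. j \<in> Field r \<Longrightarrow> (j, t) \<in> r" "f t = L"
    using P[THEN conjunct2, THEN conjunct2, THEN conjunct1] by blast
  have wf: "wf (r - Id)"
    using wo by (simp add: well_order_on_def)
  have refl: "(i, i) \<in> r" if "i \<in> Field r" for i
    using wo that
    unfolding well_order_on_def linear_order_on_def partial_order_on_def preorder_on_def
    by (auto dest: refl_onD)
  have tot: "total_on (Field r) r"
    using wo unfolding well_order_on_def linear_order_on_def by blast
  have total: "(i, j) \<in> r \<or> j \<in> underS r i" if "i \<in> Field r" "j \<in> Field r" for i j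
    using refl[OF that(1)] tot that by (cases "i = j") (auto simp: underS_def total_on_def)
  have strict: "i \<in> underS r j" if "i \<in> Field r" "j \<in> Field r" "f i \<subset> f j" for i j
    using total[OF that(2,1)] mono[of j i] that(3) by blast
  have fldS: "i \<in> Field r" if "i \<in> underS r j" for i j
    using that by (auto simp: underS_def Field_def)
  define C where "C = f ` Field r"
  define s where "s = {(A, B). A \<in> C \<and> B \<in> C \<and> A \<subseteq> B}"
  have least: "\<exists>i\<in>Field r. f i \<in> Q \<and> (\<forall>j\<in>underS r i. f j \<notin> Q)"
    if "A \<in> C" "A \<in> Q" for A Q
  proof -
    obtain k where "k \<in> {i \<in> Field r. f i \<in> Q}"
      using \<open>A \<in> C\<close> \<open>A \<in> Q\<close> by (auto simp: C_def)
    then obtain i where i: "i \<in> {i \<in> Field r. f i \<in> Q}"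
      "\<And>j. (j, i) \<in> r - Id \<Longrightarrow> j \<notin> {i \<in> Field r. f i \<in> Q}"
      by (rule wfE_min[OF wf]) blast
    have "f j \<notin> Q" if "j \<in> underS r i" for j
      using i(2)[of j] fldS[OF that] that by (auto simp: underS_def)
    with i(1) show ?thesis by blast
  qed
  have chain: "A \<subseteq> B \<or> B \<subseteq> A" if "A \<in> C" "B \<in> C" for A B
  proof -
    obtain i j where "i \<in> Field r" "A = f i" "j \<in> Field r" "B = f j"
      using \<open>A \<in> C\<close> \<open>B \<in> C\<close> by (auto simp: C_def)
    then show ?thesis
      using total[of i j] mono[of i j] mono[of j i] by (auto simp: underS_def)
  qed
  have fld: "Field s = C"
    unfolding s_def Field_def by auto
  have uS: "underS s B = {A \<in> C. A \<subset> B}" if "B \<in> C" for B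
    using that by (auto simp: underS_def s_def)
  have lin: "Linear_order s"
    unfolding linear_order_on_def partial_order_on_def preorder_on_def fld
    using chain by (auto simp: s_def refl_on_def trans_def antisym_def total_on_def)
  moreover have "wf (s - Id)"
  proof (rule wfI_min)
    fix A :: "'v set" and Q assume "A \<in> Q"
    show "\<exists>z\<in>Q. \<forall>y. (y, z) \<in> s - Id \<longrightarrow> y \<notin> Q"
    proof (cases "A \<in> C")
      case False
      then show ?thesis using \<open>A \<in> Q\<close> by (auto simp: s_def)
    next
      case True
      then obtain i where i: "i \<in> Field r" "f i \<in> Q" "\<forall>j\<in>underS r i. f j \<notin> Q"
        using least[OF True \<open>A \<in> Q\<close>] by blast
      have "y \<notin> Q" if y: "(y, f i) \<in> s - Id" for y
      proof -
        obtain j where j: "j \<in> Field r" "y = f j" "f j \<subset> f i"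
          using y by (auto simp: s_def C_def)
        then show ?thesis using i(3) strict[OF j(1) i(1) j(3)] by blast
      qed
      then show ?thesis using i(2) by blast
    qed
  qed
  ultimately have wos: "Well_order s"
    by (simp add: well_order_on_def)
  have first: "\<exists>i. i \<in> Field r \<and> f i = B \<and> (\<forall>j\<in>underS r i. f j \<subset> B)" if "B \<in> C" for B
  proof -
    obtain i where i: "i \<in> Field r" "f i = B" "\<And>j. j \<in> underS r i \<Longrightarrow> f j \<noteq> B"
      using least[OF \<open>B \<in> C\<close>, of "{B}"] by blast
    have "f j \<subset> B" if "j \<in> underS r i" for j
      using mono[of j i] i(2) i(3)[OF that] that by (auto simp: underS_def)
    with i show ?thesis by blast
  qed
  have succ: "abelian_factor bracket B A" if "is_succ s A B" for A B
  proof -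
    have AB: "A \<in> C" "B \<in> C" "A \<subset> B"
      using that by (auto simp: is_succ_def underS_def s_def)
    have gap: "D \<subseteq> A" if "D \<in> C" "D \<subset> B" for D
    proof (rule ccontr)
      assume "\<not> D \<subseteq> A"
      then have "A \<in> underS s D"
        using chain[OF AB(1) \<open>D \<in> C\<close>] uS[OF \<open>D \<in> C\<close>] AB(1) by blast
      then have "(B, D) \<in> s"
        using \<open>is_succ s A B\<close> unfolding is_succ_def by blast
      then show False using \<open>D \<subset> B\<close> unfolding s_def by blast
    qed
    obtain i where i: "i \<in> Field r" "f i = B" and "\<forall>j\<in>underS r i. f j \<subset> B"
      using first[OF AB(2)] by (elim exE conjE) (erule (2) that)
    then have below_i: "f j \<subset> B" if "j \<in> underS r i" for j
      using that by (elim bspec)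
    have below: "f j \<subseteq> A" if "j \<in> underS r i" for j
      using gap[of "f j"] below_i[OF that] fldS[OF that] by (auto simp: C_def)
    obtain a where a: "a \<in> Field r" "f a = A"
      using AB(1) by (auto simp: C_def)
    then have ne: "underS r i \<noteq> {}"
      using strict[OF a(1) i(1)] AB(3) i(2) by blast
    show ?thesis
    proof (cases "\<exists>k. is_succ r k i")
      case True
      then obtain k where k: "is_succ r k i" by blast
      then have "f k \<subseteq> A" using below by (simp add: is_succ_def)
      then show ?thesis
        using factor[OF k] i(2) by (auto simp: abelian_factor_def)
    next
      case False
      then have "B \<subseteq> A" using limit[OF i(1) ne] below i(2) by blast
      then show ?thesis using AB(3) by blast
    qed
  qed
  have lim: "B = (\<Union>A\<in>underS s B. A)"
    if B: "B \<in> C" "underS s B \<noteq> {}" "\<nexists>A. is_succ s A B" for B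
  proof -
    obtain i where i: "i \<in> Field r" "f i = B" and "\<forall>j\<in>underS r i. f j \<subset> B"
      using first[OF B(1)] by (elim exE conjE) (erule (2) that)
    then have below_i: "f j \<subset> B" if "j \<in> underS r i" for j
      using that by (elim bspec)
    obtain a where a: "a \<in> Field r" "f a \<subset> B"
      using B(2) uS[OF B(1)] by (auto simp: C_def)
    then have ne: "underS r i \<noteq> {}"
      using strict[OF a(1) i(1)] i(2) by blast
    have "\<nexists>k. is_succ r k i"
    proof
      assume "\<exists>k. is_succ r k i"
      then obtain k where k: "is_succ r k i" by blast
      then have ki: "k \<in> underS r i" by (simp add: is_succ_def)
      have "(B, D) \<in> s" if D: "f k \<in> underS s D" for D
      proof -
        have "D \<in> C" using D by (auto simp: underS_def s_def)
        then obtain d where d: "d \<in> Field r" "f d = D" by (auto simp: C_def)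
        have "f k \<subset> f d" using D d(2) uS[OF \<open>D \<in> C\<close>] by blast
        then have "k \<in> underS r d"
          using strict[OF fldS[OF ki] d(1)] by blast
        then have "(i, d) \<in> r" using k by (simp add: is_succ_def)
        then show ?thesis using mono[of i d] i(2) d(2) B(1) \<open>D \<in> C\<close> by (auto simp: s_def)
      qed
      moreover have "f k \<in> underS s B"
        using below_i[OF ki] uS[OF B(1)] fldS[OF ki] by (auto simp: C_def)
      ultimately have "is_succ s (f k) B" by (simp add: is_succ_def)
      then show False using B(3) by blast
    qed
    then have "B = (\<Union>j\<in>underS r i. f j)" using limit[OF i(1) ne] i(2) by blast
    moreover have "f j \<in> underS s B" if "j \<in> underS r i" for j
      using below_i[OF that] uS[OF B(1)] fldS[OF that] by (auto simp: C_def)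
    ultimately have "B \<subseteq> (\<Union>A\<in>underS s B. A)" by blast
    then show ?thesis using uS[OF B(1)] by blast
  qed
  have bC: "f b \<in> C" and tC: "f t \<in> C" using b t by (auto simp: C_def)
  have bot: "(f b, A) \<in> s" if "A \<in> C" for A
  proof -
    obtain i where "i \<in> Field r" "A = f i" using \<open>A \<in> C\<close> by (auto simp: C_def)
    then show ?thesis using mono[OF b(2)] bC that by (simp add: s_def)
  qed
  have top: "(A, f t) \<in> s" if "A \<in> C" for A
  proof -
    obtain i where "i \<in> Field r" "A = f i" using \<open>A \<in> C\<close> by (auto simp: C_def)
    then show ?thesis using mono[OF t(2)] tC that by (simp add: s_def)
  qed
  have "ascending_abelian_series scale bracket L s id"
    unfolding ascending_abelian_series_def fld
  proof (intro conjI)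
    show "\<exists>i\<in>C. (\<forall>j\<in>C. (i, j) \<in> s) \<and> id i = {0}" using bC bot b(3) by auto
    show "\<exists>i\<in>C. (\<forall>j\<in>C. (j, i) \<in> s) \<and> id i = L" using tC top t(3) by auto
    show "\<forall>i\<in>C. lie_ideal scale bracket (id i) L" using ideal by (auto simp: C_def)
    show "\<forall>i j. (i, j) \<in> s \<longrightarrow> id i \<subseteq> id j" by (auto simp: s_def)
    show "\<forall>i j. is_succ s i j \<longrightarrow> abelian_factor bracket (id j) (id i)" using succ by auto
    show "\<forall>j\<in>C. underS s j \<noteq> {} \<and> (\<nexists>i. is_succ s i j) \<longrightarrow> id j = (\<Union>i\<in>underS s j. id i)"
      using lim by auto
  qed (rule wos[unfolded fld])
  then show ?thesis unfolding hyperabelian_def by blast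
qed

end

theory Submission
  imports Defs
begin

text \<open>
  Let \<open>A\<close> be a maximal abelian ideal. Every subspace of an abelian ideal is an abelian subideal,
  hence an ideal, so every element of \<open>L\<close> acts on \<open>A\<close> as a scalar. If the centralizer \<open>C\<close> of \<open>A\<close>
  were larger than \<open>A\<close>, hyperabelianity would give an ideal \<open>B\<close> with \<open>A \<subset> B \<subseteq> C\<close> and
  \<open>[B, B] \<subseteq> A\<close>; for \<open>b \<in> B - A\<close> the space \<open>A + Fb\<close> is an abelian ideal of \<open>B\<close>, hence an ideal
  of \<open>L\<close>, against maximality. So \<open>C = A\<close>, and the scalar action embeds \<open>L/A\<close> into \<open>F\<close>.
  A subideal not contained in \<open>A\<close> has an element acting on \<open>A\<close> as a nonzero scalar; descending
  its chain, each term absorbs \<open>A\<close>, so it is all of \<open>L\<close>.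
\<close>

text \<open>Fix a nonzero \<open>a\<close> with eigenvalue \<mu> and compare \<open>b\<close> with
  \<open>a + b\<close>. Either their eigenvalues agree, which forces both to be \<mu>, or
  \<open>b\<close> is a multiple of \<open>a\<close> and inherits \<mu> by linearity.\<close>

lemma (in vector_space) scalar_if_all_eigenvectors:
  assumes lin: "Vector_Spaces.linear scale scale f"
    and A: "subspace A"
    and eigen: "\<And>a. a \<in> A \<Longrightarrow> f a \<in> span {a}"
  shows "\<exists>\<mu>. \<forall>a\<in>A. f a = \<mu> *s a"
proof (cases "A \<subseteq> {0}")
  case True
  have "f 0 = 0" using eigen[of 0] subspace_0[OF A] by simp
  then show ?thesis using True by (intro exI[of _ 0]) auto
next
  case False
  interpret f: Vector_Spaces.linear scale scale f by (rule lin)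
  from False obtain a where a: "a \<in> A" "a \<noteq> 0" by auto
  obtain \<mu> where \<mu>: "f a = \<mu> *s a" using eigen[OF a(1)] by (auto simp: span_singleton)
  have "f b = \<mu> *s b" if b: "b \<in> A" for b
  proof -
    obtain \<nu> where \<nu>: "f b = \<nu> *s b" using eigen[OF b] by (auto simp: span_singleton)
    obtain \<kappa> where \<kappa>: "f (a + b) = \<kappa> *s (a + b)"
      using eigen[OF subspace_add[OF A a(1) b]] by (auto simp: span_singleton)
    have "\<mu> *s a + \<nu> *s b = \<kappa> *s a + \<kappa> *s b"
      using \<kappa> \<mu> \<nu> by (simp add: f.add scale_right_distrib)
    then have eq: "(\<nu> - \<kappa>) *s b = (\<kappa> - \<mu>) *s a"
      by (simp add: scale_left_diff_distrib algebra_simps)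
    show ?thesis
    proof (cases "\<nu> = \<kappa>")
      case True
      then show ?thesis using eq a(2) \<nu> by simp
    next
      case False
      then have "b = ((\<kappa> - \<mu>) / (\<nu> - \<kappa>)) *s a"
        using arg_cong[OF eq, of "scale (inverse (\<nu> - \<kappa>))"] by (simp add: divide_inverse mult.commute)
      then obtain c where "b = c *s a" by blast
      then show ?thesis using \<mu> by (simp add: f.scale mult.commute)
    qed
  qed
  then show ?thesis by blast
qed

context lie_algebra
begin

section \<open>Bracket identities and elementary facts on ideals\<close>

lemma bracket_add_right: "bracket x (y + z) = bracket x y + bracket x z"
  and bracket_scale_right: "bracket x (scale c y) = scale c (bracket x y)"
  and bracket_zero_right: "bracket x 0 = 0"
proof -
  interpret l: Vector_Spaces.linear scale scale "bracket x" by (rule linear_right)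
  show "bracket x (y + z) = bracket x y + bracket x z" by (rule l.add)
  show "bracket x (scale c y) = scale c (bracket x y)" by (rule l.scale)
  show "bracket x 0 = 0" by (rule l.zero)
qed

lemma bracket_add_left: "bracket (x + y) z = bracket x z + bracket y z"
  and bracket_diff_left: "bracket (x - y) z = bracket x z - bracket y z"
  and bracket_scale_left: "bracket (scale c x) z = scale c (bracket x z)"
  and bracket_zero_left: "bracket 0 z = 0"
proof -
  interpret l: Vector_Spaces.linear scale scale "\<lambda>x. bracket x z" by (rule linear_left)
  show "bracket (x + y) z = bracket x z + bracket y z" by (rule l.add)
  show "bracket (x - y) z = bracket x z - bracket y z" by (rule l.diff)
  show "bracket (scale c x) z = scale c (bracket x z)" by (rule l.scale)
  show "bracket 0 z = 0" by (rule l.zero)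
qed

lemmas bracket_simps =
  bracket_add_right bracket_scale_right bracket_zero_right
  bracket_add_left bracket_diff_left bracket_scale_left bracket_zero_left

lemma bracket_anticomm: "bracket x y = - bracket y x"
  using alternating[of "x + y"] alternating[of x] alternating[of y]
  by (simp add: bracket_simps eq_neg_iff_add_eq_0 add.commute)

lemma lie_ideal_imp_subalgebra:
  "lie_ideal scale bracket I S \<Longrightarrow> lie_subalgebra scale bracket I"
  by (auto simp: lie_ideal_def lie_subalgebra_def)

lemma lie_ideal_bracket_right: "lie_ideal scale bracket I S \<Longrightarrow> x \<in> S \<Longrightarrow> y \<in> I \<Longrightarrow> bracket x y \<in> I"
  by (simp add: lie_ideal_def)

lemma lie_ideal_bracket_left: "lie_ideal scale bracket I S \<Longrightarrow> x \<in> S \<Longrightarrow> y \<in> I \<Longrightarrow> bracket y x \<in> I"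
  using bracket_anticomm[of y x] by (auto simp: lie_ideal_def intro: subspace_neg)

lemma lie_ideal_imp_subspace: "lie_ideal scale bracket I S \<Longrightarrow> subspace I"
  by (simp add: lie_ideal_def)

text \<open>Every application of the hypothesis on abelian subideals goes through such a two-step
  chain.\<close>

lemma subidealI_ideal_of_ideal:
  assumes "lie_ideal scale bracket S B" "lie_ideal scale bracket B UNIV"
  shows "lie_subideal scale bracket S UNIV"
proof -
  define T where "T i = (if i = 0 then S else if i = 1 then B else UNIV)" for i :: nat
  have "lie_subalgebra scale bracket UNIV"
    by (simp add: lie_subalgebra_def)
  then have "\<forall>i\<le>2. lie_subalgebra scale bracket (T i)"
    using assms by (auto simp: T_def intro: lie_ideal_imp_subalgebra)
  moreover have "\<forall>i<2. lie_ideal scale bracket (T i) (T (Suc i))"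
    using assms by (auto simp: T_def less_2_cases_iff)
  ultimately show ?thesis
    unfolding lie_subideal_def by (intro exI[of _ "2::nat"] exI[of _ T]) (simp add: T_def)
qed

lemma subspace_of_abelian_is_ideal:
  assumes "lie_abelian bracket A" "subspace U" "U \<subseteq> A"
  shows "lie_ideal scale bracket U A"
  using assms subspace_0[of U] by (auto simp: lie_ideal_def lie_abelian_def)

lemma abelian_subset: "lie_abelian bracket A \<Longrightarrow> U \<subseteq> A \<Longrightarrow> lie_abelian bracket U"
  by (auto simp: lie_abelian_def)

section \<open>Constructing ideals from ideals\<close>

definition centralizer :: "'v set \<Rightarrow> 'v set" where
  "centralizer A = {x. \<forall>a\<in>A. bracket x a = 0}"

text \<open>By the Jacobi identity: for \<open>y\<close> centralizing \<open>A\<close> and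
  \<open>a\<close> in \<open>A\<close>, the term \<open>bracket y (bracket a x)\<close> vanishes
  because \<open>A\<close> contains \<open>bracket a x\<close>, and
  \<open>bracket x (bracket y a)\<close> vanishes as well.\<close>

lemma ideal_centralizer:
  assumes A: "lie_ideal scale bracket A UNIV"
  shows "lie_ideal scale bracket (centralizer A) UNIV"
  unfolding lie_ideal_def
proof (intro conjI ballI)
  show "subspace (centralizer A)"
    by (rule subspaceI) (auto simp: centralizer_def bracket_simps)
  fix x y assume y: "y \<in> centralizer A"
  show "bracket x y \<in> centralizer A"
    unfolding centralizer_def
  proof (intro CollectI ballI)
    fix a assume a: "a \<in> A"
    have "bracket y (bracket a x) = 0"
      using y lie_ideal_bracket_left[OF A _ a, of x] by (simp add: centralizer_def)
    moreover have "bracket x (bracket y a) = 0"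
      using y a by (simp add: centralizer_def bracket_simps)
    ultimately have "bracket a (bracket x y) = 0"
      using jacobi[of a x y] by simp
    then show "bracket (bracket x y) a = 0"
      using bracket_anticomm[of "bracket x y" a] by simp
  qed
qed simp

lemma ideal_sum:
  assumes I: "lie_ideal scale bracket I UNIV" and J: "lie_ideal scale bracket J UNIV"
  shows "lie_ideal scale bracket {x + y |x y. x \<in> I \<and> y \<in> J} UNIV"
proof -
  have "subspace {x + y |x y. x \<in> I \<and> y \<in> J}"
    using subspace_sums I J by (simp add: lie_ideal_def)
  then show ?thesis
    using I J by (auto simp: lie_ideal_def bracket_simps) blast
qed

lemma ideal_Int:
  "lie_ideal scale bracket I S \<Longrightarrow> lie_ideal scale bracket J S \<Longrightarrow>
    lie_ideal scale bracket (I \<inter> J) S"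
  by (auto simp: lie_ideal_def subspace_inter)

section \<open>Maximal abelian ideals and their centralizers\<close>

lemma ex_maximal_abelian_ideal:
  "\<exists>A. lie_ideal scale bracket A UNIV \<and> lie_abelian bracket A \<and>
    (\<forall>B. lie_ideal scale bracket B UNIV \<longrightarrow> lie_abelian bracket B \<longrightarrow> A \<subseteq> B \<longrightarrow> B = A)"
proof -
  let ?P = "{A. lie_ideal scale bracket A UNIV \<and> lie_abelian bracket A}"
  have "{0} \<in> ?P"
    by (simp add: lie_ideal_def lie_abelian_def bracket_simps)
  then have ne: "?P \<noteq> {}" by blast
  have "\<Union>C \<in> ?P" if "C \<noteq> {}" "subset.chain ?P C" for C
  proof -
    have C: "\<And>I. I \<in> C \<Longrightarrow> lie_ideal scale bracket I UNIV"
      "\<And>I. I \<in> C \<Longrightarrow> lie_abelian bracket I"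
      using that(2) by (auto simp: subset.chain_def)
    \<comment> \<open>Closure under addition and commutativity involve two elements at once;
      comparability in the chain puts them into one member.\<close>
    have common: "\<exists>I\<in>C. x \<in> I \<and> y \<in> I" if xy: "x \<in> \<Union>C" "y \<in> \<Union>C" for x y
    proof -
      obtain I J where "I \<in> C" "x \<in> I" "J \<in> C" "y \<in> J" using xy by blast
      then show ?thesis
        using \<open>subset.chain ?P C\<close> unfolding subset_chain_def by blast
    qed
    have "subspace (\<Union>C)"
    proof (rule subspaceI)
      show "0 \<in> \<Union>C" using \<open>C \<noteq> {}\<close> C(1) lie_ideal_imp_subspace subspace_0 by fast
      show "x + y \<in> \<Union>C" if "x \<in> \<Union>C" "y \<in> \<Union>C" for x y
        using common[OF that] C(1) lie_ideal_imp_subspace subspace_add by fast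
      show "scale c x \<in> \<Union>C" if "x \<in> \<Union>C" for c x
        using that C(1) lie_ideal_imp_subspace subspace_scale by fast
    qed
    moreover have "bracket x y \<in> \<Union>C" if "y \<in> \<Union>C" for x y
      using that C(1) lie_ideal_bracket_right by fast
    ultimately have "lie_ideal scale bracket (\<Union>C) UNIV"
      by (simp add: lie_ideal_def)
    moreover have "lie_abelian bracket (\<Union>C)"
      using common C(2) unfolding lie_abelian_def by meson
    ultimately show ?thesis by simp
  qed
  from subset_Zorn_nonempty[OF ne this] show ?thesis by blast
qed

text \<open>Take the least index \<open>i\<close> whose term meets \<open>C\<close> outside
  \<open>A\<close>, and let \<open>B\<close> be the sum of \<open>A\<close> and \<open>f i\<close>
  \<inter> \<open>C\<close>. Such an \<open>i\<close> is a successor, so brackets within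
  \<open>f i\<close> \<inter> \<open>C\<close> fall into the preceding term and into
  \<open>C\<close>, hence into \<open>A\<close>.\<close>

lemma hyperabelian_ex_abelian_factor:
  assumes hyp: "hyperabelian scale bracket UNIV"
    and A: "lie_ideal scale bracket A UNIV" and C: "lie_ideal scale bracket C UNIV"
    and "A \<subset> C"
  shows "\<exists>B. lie_ideal scale bracket B UNIV \<and> A \<subset> B \<and> B \<subseteq> C \<and> abelian_factor bracket B A"
proof -
  obtain r :: "'v set rel" and f where "ascending_abelian_series scale bracket UNIV r f"
    using hyp unfolding hyperabelian_def by blast
  note P = this[unfolded ascending_abelian_series_def]
  note wo = P[THEN conjunct1]
  have ideal: "\<And>i. i \<in> Field r \<Longrightarrow> lie_ideal scale bracket (f i) UNIV"
    using P[THEN conjunct2, THEN conjunct2, THEN conjunct2, THEN conjunct1] by simp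
  have factor: "\<And>i j. is_succ r i j \<Longrightarrow> abelian_factor bracket (f j) (f i)"
    using P[THEN conjunct2, THEN conjunct2, THEN conjunct2, THEN conjunct2, THEN conjunct2,
        THEN conjunct1] by simp
  have limit: "\<And>j. j \<in> Field r \<Longrightarrow> underS r j \<noteq> {} \<Longrightarrow> \<nexists>i. is_succ r i j \<Longrightarrow>
                 f j = (\<Union>i\<in>underS r j. f i)"
    using P[THEN conjunct2, THEN conjunct2, THEN conjunct2, THEN conjunct2, THEN conjunct2,
        THEN conjunct2] by simp
  obtain b where b: "b \<in> Field r" "\<And>j. j \<in> Field r \<Longrightarrow> (b, j) \<in> r" "f b = {0}"
    using P[THEN conjunct2, THEN conjunct1] by blast
  obtain t where t: "t \<in> Field r" "f t = UNIV"
    using P[THEN conjunct2, THEN conjunct2, THEN conjunct1] by blast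
  let ?Q = "{i \<in> Field r. \<not> f i \<inter> C \<subseteq> A}"
  have "wf (r - Id)" using wo by (simp add: well_order_on_def)
  moreover have "t \<in> ?Q" using t \<open>A \<subset> C\<close> by auto
  ultimately obtain i where i: "i \<in> ?Q" and min: "\<And>j. (j, i) \<in> r - Id \<Longrightarrow> j \<notin> ?Q"
    by (rule wfE_min) (rule that)
  have below: "f j \<inter> C \<subseteq> A" if "j \<in> underS r i" for j
    using min[of j] that by (auto simp: underS_def Field_def)
  \<comment> \<open>The bottom term is zero and so lies in \<open>A\<close>; hence \<open>i\<close>
    has predecessors, as the limit clause requires.\<close>
  have "b \<noteq> i" using i b(3) subspace_0[OF lie_ideal_imp_subspace[OF A]] by auto
  then have ne: "underS r i \<noteq> {}" using b(2)[of i] i by (auto simp: underS_def)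
  \<comment> \<open>At a limit, \<open>f i\<close> would be the union of earlier terms, each meeting
    \<open>C\<close> only inside \<open>A\<close>.\<close>
  have "\<exists>j. is_succ r j i"
  proof (rule ccontr)
    assume "\<not> ?thesis"
    then have "f i = (\<Union>j\<in>underS r i. f j)" using limit[OF _ ne] i by blast
    then show False using below i by blast
  qed
  then obtain j where j: "is_succ r j i" by blast
  then have fj: "f j \<inter> C \<subseteq> A" using below by (simp add: is_succ_def)
  let ?B = "{x + y |x y. x \<in> A \<and> y \<in> f i \<inter> C}"
  have fiC: "lie_ideal scale bracket (f i \<inter> C) UNIV"
    using ideal_Int[OF ideal C] i by blast
  note sA = lie_ideal_imp_subspace[OF A]
  have "A \<subseteq> ?B"
    using subspace_0[OF lie_ideal_imp_subspace[OF fiC]] by force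
  moreover have "f i \<inter> C \<subseteq> ?B" using subspace_0[OF sA] by force
  ultimately have "A \<subset> ?B" using i by blast
  moreover have "?B \<subseteq> C"
    using \<open>A \<subset> C\<close> subspace_add[OF lie_ideal_imp_subspace[OF C]] by blast
  moreover have "abelian_factor bracket ?B A"
    unfolding abelian_factor_def
  proof (intro ballI)
    fix u v assume "u \<in> ?B" "v \<in> ?B"
    then obtain x y z w where uv: "u = x + y" "v = z + w"
      and mem: "x \<in> A" "z \<in> A" "y \<in> f i" "y \<in> C" "w \<in> f i" "w \<in> C" by blast
    \<comment> \<open>Only this summand of \<open>bracket u v\<close> needs the abelian factor; the
      others involve \<open>x\<close> or \<open>z\<close> from the ideal \<open>A\<close>.\<close>
    have "bracket y w \<in> f j"
      using factor[OF j] mem by (simp add: abelian_factor_def)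
    moreover have "bracket y w \<in> C" using lie_ideal_bracket_right[OF C] mem by simp
    ultimately have "bracket y w \<in> A" using fj by blast
    moreover have "bracket x v \<in> A" using lie_ideal_bracket_left[OF A] mem by simp
    moreover have "bracket y z \<in> A" using lie_ideal_bracket_right[OF A] mem by simp
    moreover have "bracket u v = bracket x v + (bracket y z + bracket y w)"
      unfolding uv by (simp add: bracket_simps)
    ultimately show "bracket u v \<in> A" by (simp add: subspace_add[OF sA])
  qed
  ultimately show ?thesis using ideal_sum[OF A fiC] by blast
qed

text \<open>Used to conclude that an element acting on \<open>A\<close> as zero already lies in
  \<open>A\<close>.\<close>

lemma centralizer_maximal_abelian_ideal:
  assumes hyp: "hyperabelian scale bracket UNIV"
    and subideals: "\<And>S. lie_subideal scale bracket S UNIV \<Longrightarrow> lie_abelian bracket S \<Longrightarrow>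
                      lie_ideal scale bracket S UNIV"
    and A: "lie_ideal scale bracket A UNIV" and ab: "lie_abelian bracket A"
    and max: "\<And>B. lie_ideal scale bracket B UNIV \<Longrightarrow> lie_abelian bracket B \<Longrightarrow> A \<subseteq> B \<Longrightarrow> B = A"
  shows "centralizer A = A"
proof (rule ccontr)
  assume "centralizer A \<noteq> A"
  then have "A \<subset> centralizer A"
    using ab by (auto simp: centralizer_def lie_abelian_def)
  then obtain B where B: "lie_ideal scale bracket B UNIV" "A \<subset> B" "B \<subseteq> centralizer A"
    "abelian_factor bracket B A"
    using hyperabelian_ex_abelian_factor[OF hyp A ideal_centralizer[OF A]] by blast
  then obtain b where b: "b \<in> B" "b \<notin> A" by blast
  note sA = lie_ideal_imp_subspace[OF A] and sB = lie_ideal_imp_subspace[OF B(1)]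
  let ?S = "{a + x |a x. a \<in> A \<and> x \<in> span {b}}"
  have AS: "A \<subseteq> ?S" using span_zero by force
  have bS: "b \<in> ?S" using subspace_0[OF sA] span_base[of b "{b}"] by force
  have "span {b} \<subseteq> B" using b sB by (simp add: span_minimal)
  then have SB: "?S \<subseteq> B" using B(2) subspace_add[OF sB] by blast
  have "lie_ideal scale bracket ?S B"
    unfolding lie_ideal_def
  proof (intro conjI ballI)
    show "subspace ?S" by (rule subspace_sums[OF sA subspace_span])
    show "?S \<subseteq> B" by (rule SB)
    fix x y assume "x \<in> B" "y \<in> ?S"
    \<comment> \<open>Any subspace between \<open>A\<close> and \<open>B\<close> is an ideal of
      \<open>B\<close>, because brackets within \<open>B\<close> land in \<open>A\<close>.\<close>
    then show "bracket x y \<in> ?S" using B(4) SB AS unfolding abelian_factor_def by blast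
  qed
  then have sub: "lie_subideal scale bracket ?S UNIV" using B(1) by (rule subidealI_ideal_of_ideal)
  have "lie_abelian bracket ?S"
    unfolding lie_abelian_def
  proof (intro ballI)
    fix u v assume "u \<in> ?S" "v \<in> ?S"
    then obtain x z c e where uv: "u = x + scale c b" "v = z + scale e b" "x \<in> A" "z \<in> A"
      by (auto simp: span_singleton)
    have "bracket b a = 0" if "a \<in> A" for a
      using b B(3) that by (auto simp: centralizer_def)
    then have "bracket b z = 0" "bracket x b = 0"
      using uv(3,4) bracket_anticomm[of x b] by simp_all
    then show "bracket u v = 0"
      using uv ab by (simp add: bracket_simps alternating lie_abelian_def)
  qed
  then have "?S = A" using max[OF subideals[OF sub] _ AS] by blast
  then show False using bS b(2) by blast
qed

section \<open>Scalar action on an abelian ideal\<close>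

lemma scalar_action_on_abelian_ideal:
  assumes subideals: "\<And>S. lie_subideal scale bracket S UNIV \<Longrightarrow> lie_abelian bracket S \<Longrightarrow>
                      lie_ideal scale bracket S UNIV"
    and A: "lie_ideal scale bracket A UNIV" and ab: "lie_abelian bracket A"
  shows "\<exists>\<mu>. \<forall>a\<in>A. bracket x a = scale \<mu> a"
proof (rule scalar_if_all_eigenvectors[OF linear_right lie_ideal_imp_subspace[OF A]])
  fix a assume "a \<in> A"
  then have sub: "span {a} \<subseteq> A" by (simp add: span_minimal lie_ideal_imp_subspace[OF A])
  have "lie_ideal scale bracket (span {a}) UNIV"
    using subideals[OF subidealI_ideal_of_ideal[OF subspace_of_abelian_is_ideal A]]
      ab sub abelian_subset by simp
  then show "bracket x a \<in> span {a}"
    using lie_ideal_bracket_right span_base by fast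
qed

text \<open>If a term of the chain contains \<open>A\<close>, the next one down contains
  \<open>bracket s a\<close>, since it contains \<open>s\<close> and is an ideal there. Dividing by
  \<open>c\<close> recovers \<open>a\<close>.\<close>

lemma subideal_contains_eigenvectors:
  assumes S: "lie_subideal scale bracket S UNIV"
    and s: "s \<in> S" and eigen: "\<And>a. a \<in> A \<Longrightarrow> bracket s a = scale c a" and "c \<noteq> 0"
  shows "A \<subseteq> S"
proof -
  obtain n T where T: "T 0 = S" "T n = UNIV"
    "\<And>i. i < n \<Longrightarrow> lie_ideal scale bracket (T i) (T (Suc i))"
    using S unfolding lie_subideal_def by blast
  have sT: "s \<in> T i" if "i \<le> n" for i
    using that
  proof (induction i)
    case 0
    then show ?case using s T(1) by simp
  next
    case (Suc i)
    then show ?case using T(3)[of i] by (auto simp: lie_ideal_def)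
  qed
  \<comment> \<open>Here \<open>k\<close> counts steps down from the top, so the induction starts at
    \<open>T n\<close>, the whole algebra.\<close>
  have "A \<subseteq> T (n - k)" if "k \<le> n" for k
    using that
  proof (induction k)
    case 0
    then show ?case using T(2) by simp
  next
    case (Suc k)
    let ?i = "n - Suc k"
    have id: "lie_ideal scale bracket (T ?i) (T (n - k))"
      using T(3)[of ?i] Suc.prems by (simp add: Suc_diff_Suc)
    show ?case
    proof
      fix a assume a: "a \<in> A"
      then have "bracket s a \<in> T ?i"
        using Suc lie_ideal_bracket_left[OF id, of a s] sT[of ?i] by auto
      then have "scale (inverse c) (scale c a) \<in> T ?i"
        unfolding eigen[OF a] by (rule subspace_scale[OF lie_ideal_imp_subspace[OF id]])
      then show "a \<in> T ?i" using \<open>c \<noteq> 0\<close> by simp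
    qed
  qed
  from this[of n] show ?thesis using T(1) by simp
qed

end

theorem theoremB:
  fixes scale :: "'a::field \<Rightarrow> 'v::ab_group_add \<Rightarrow> 'v"
    and bracket :: "'v \<Rightarrow> 'v \<Rightarrow> 'v"
  assumes "lie_algebra scale bracket"
    and "hyperabelian scale bracket UNIV"
    and "\<not> lie_abelian bracket UNIV"
    and "\<And>S. lie_subideal scale bracket S UNIV \<Longrightarrow> lie_abelian bracket S \<Longrightarrow>
           lie_ideal scale bracket S UNIV"
  shows "(\<exists>A d. lie_ideal scale bracket A UNIV \<and> lie_abelian bracket A \<and>
            {a + x |a x. a \<in> A \<and> x \<in> module.span scale {d}} = UNIV \<and>
            A \<inter> module.span scale {d} = {0} \<and>
            (\<forall>a\<in>A. bracket d a = a)) \<and>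
         (\<forall>S. lie_subideal scale bracket S UNIV \<longrightarrow> lie_ideal scale bracket S UNIV)"
proof -
  interpret lie_algebra scale bracket by (rule assms(1))
  obtain A where A: "lie_ideal scale bracket A UNIV" and ab: "lie_abelian bracket A"
    and max: "\<And>B. lie_ideal scale bracket B UNIV \<Longrightarrow> lie_abelian bracket B \<Longrightarrow> A \<subseteq> B \<Longrightarrow> B = A"
    using ex_maximal_abelian_ideal by blast
  note sA = lie_ideal_imp_subspace[OF A]
  have cent: "centralizer A = A"
    by (rule centralizer_maximal_abelian_ideal[OF assms(2,4) A ab max])
  have scalar: "\<exists>\<mu>. \<forall>a\<in>A. bracket x a = scale \<mu> a" for x
    by (rule scalar_action_on_abelian_ideal[OF assms(4) A ab])
  have "A \<noteq> UNIV" using ab assms(3) by blast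
  \<comment> \<open>As \<open>A\<close> is its own centralizer, an element outside it acts on
    \<open>A\<close> by a nonzero scalar, which \<open>a\<^sub>0\<close> witnesses.\<close>
  then obtain d' where "d' \<notin> centralizer A" unfolding cent by blast
  moreover obtain \<mu> where \<mu>: "\<forall>a\<in>A. bracket d' a = scale \<mu> a" using scalar by blast
  ultimately obtain a\<^sub>0 where a\<^sub>0: "a\<^sub>0 \<in> A" "scale \<mu> a\<^sub>0 \<noteq> 0"
    by (auto simp: centralizer_def)
  \<comment> \<open>Rescaling turns the eigenvalue on \<open>A\<close> into 1.\<close>
  define d where "d = scale (inverse \<mu>) d'"
  have d: "bracket d a = a" if "a \<in> A" for a
    using \<mu> that a\<^sub>0 by (simp add: d_def bracket_simps)
  have decomp: "\<exists>a c. a \<in> A \<and> x = a + scale c d" for x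
  proof -
    obtain \<nu> where "\<forall>a\<in>A. bracket x a = scale \<nu> a" using scalar by blast
    \<comment> \<open>Both \<open>x\<close> and \<open>scale \<nu> d\<close> act on \<open>A\<close>
      as \<nu>, so their difference acts as zero.\<close>
    then have "x - scale \<nu> d \<in> centralizer A"
      by (simp add: centralizer_def bracket_simps d)
    then show ?thesis unfolding cent by (intro exI[of _ "x - scale \<nu> d"] exI[of _ \<nu>]) simp
  qed
  have "{a + x |a x. a \<in> A \<and> x \<in> span {d}} = UNIV"
    using decomp by (fastforce simp: span_singleton)
  moreover have "A \<inter> span {d} = {0}"
  proof -
    \<comment> \<open>\<open>scale c d\<close> multiplies the nonzero vector
      \<open>a\<^sub>0\<close> by \<open>c\<close>, whereas elements of \<open>A\<close> annihilate
      it.\<close>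
    have "c = 0" if "scale c d \<in> A" for c
    proof -
      have "bracket (scale c d) a\<^sub>0 = 0" using ab a\<^sub>0 that by (simp add: lie_abelian_def)
      then show ?thesis using a\<^sub>0 by (auto simp: bracket_simps d)
    qed
    then show ?thesis using subspace_0[OF sA] span_zero by (auto simp: span_singleton)
  qed
  moreover have "lie_ideal scale bracket S UNIV" if S: "lie_subideal scale bracket S UNIV" for S
  proof -
    have sS: "subspace S"
      using S unfolding lie_subideal_def lie_subalgebra_def by (metis le0)
    show ?thesis
    \<comment> \<open>A subideal inside \<open>A\<close> is abelian, so the hypothesis covers it;
      any other one turns out to be the whole algebra.\<close>
    proof (cases "S \<subseteq> A")
      case True
      show ?thesis
        using assms(4)[OF subidealI_ideal_of_ideal[OF subspace_of_abelian_is_ideal[OF ab sS True] A]]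
          abelian_subset[OF ab True] .
    next
      case False
      then obtain s where s: "s \<in> S" "s \<notin> A" by blast
      obtain b c where s_eq: "b \<in> A" "s = b + scale c d" using decomp by blast
      \<comment> \<open>Otherwise \<open>s\<close> would equal \<open>b\<close>, which lies in
        \<open>A\<close>.\<close>
      then have c: "c \<noteq> 0" using s by auto
      have "bracket s a = scale c a" if "a \<in> A" for a
        using that s_eq ab by (simp add: bracket_simps d lie_abelian_def)
      then have AS: "A \<subseteq> S" using subideal_contains_eigenvectors[OF S s(1) _ c] by blast
      \<comment> \<open>With \<open>A\<close> absorbed into \<open>S\<close>, removing
        \<open>b\<close> and dividing by \<open>c\<close> recovers \<open>d\<close>.\<close>
      have "s - b \<in> S" using AS s(1) s_eq(1) subspace_diff[OF sS] by blast
      then have "scale (inverse c) (s - b) \<in> S" by (rule subspace_scale[OF sS])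
      then have dS: "d \<in> S" using c s_eq by simp
      have "x \<in> S" for x
      proof -
        obtain a e where "a \<in> A" "x = a + scale e d" using decomp by blast
        then show ?thesis using AS dS sS by (auto intro: subspace_add subspace_scale)
      qed
      then have "S = UNIV" by blast
      then show ?thesis by (simp add: lie_ideal_def)
    qed
  qed
  ultimately show ?thesis using A ab d by blast
qed

end
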